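(* There is a nonempty set $G\subseteq V(\mathrm{Sh}_{\mathbb N}^2)$ such that if $I$ is an independent set in $\mathrm{Sh}_{\mathbb N}^2[G]$, then $$\liminf_{n\to\infty}\frac{\left|I\cap\binom{[n]}{2}\right|}{\left|G\cap\binom{[n]}{2}\right|}=0.$$
   Context: $\mathbb N=\{1,2,3,\dots\}$ and $[n]=\{1,\dots,n\}$. The infinite shift graph $\mathrm{Sh}_{\mathbb N}^2$ is the graph with vertex set $V(\mathrm{Sh}_{\mathbb N}^2)=\{(x_1,x_2)\in\mathbb N^2: x_1<x_2\}$ in which two vertices $(x_1,x_2)$ and $(y_1,y_2)$ are adjacent if $x_1=y_2$ or $y_1=x_2$. For $G\subseteq V(\mathrm{Sh}_{\mathbb N}^2)$, $\mathrm{Sh}_{\mathbb N}^2[G]$ is the subgraph induced by $G$; an independent set in it is a subset $I\subseteq G$ containing no two adjacent vertices. $\binom{[n]}{2}$ is identified with the set of pairs $(x_1,x_2)$ with $1\le x_1<x_2\le n$. *)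

theory Defs
  imports Complex_Main "HOL-Library.Ramsey" "HOL-Library.Extended_Real"
begin

text \<open>
  The type nat contains 0, so positivity of the coordinates is explicit.
  Edges are unordered pairs of vertices, as in the library's predicate \<^const>\<open>indep\<close>.
\<close>

definition shift_verts :: "(nat \<times> nat) set" where
  "shift_verts = {(x1, x2). 1 \<le> x1 \<and> x1 < x2}"

definition shift_edges :: "(nat \<times> nat) set set" where
  "shift_edges = {{x, y} |x y. x \<in> shift_verts \<and> y \<in> shift_verts \<and>
                    (fst x = snd y \<or> fst y = snd x)}"

definition induced_edges :: "'a set set \<Rightarrow> 'a set \<Rightarrow> 'a set set" where
  "induced_edges E W = {e \<in> E. e \<subseteq> W}"

definition independent_set_in :: "'a set \<Rightarrow> 'a set set \<Rightarrow> 'a set \<Rightarrow> bool" where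
  "independent_set_in V E I \<longleftrightarrow> I \<subseteq> V \<and> indep I E"

definition pairs_upto :: "nat \<Rightarrow> (nat \<times> nat) set" where
  "pairs_upto n = {(x1, x2). 1 \<le> x1 \<and> x1 < x2 \<and> x2 \<le> n}"

end

theory Submission
  imports Defs
begin

text \<open>
  Join \<open>k\<close> to all of the interval \<open>[(k+1)!, (k+2)!)\<close>. These edges outnumber all the earlier ones by
  a factor of about \<open>k\<close>, so an independent set that contains none of them has density
  \<open>O(1/k)\<close> at \<open>n = (k+2)! - 1\<close>. In an independent set no number is a lower end of one pair and an
  upper end of another. Hence either infinitely many \<open>k\<close> are not lower ends of pairs in \<open>I\<close>, or
  almost all numbers are lower ends, so only finitely many are upper ends and \<open>I\<close> is finite.
\<close>

text \<open>For \<open>k\<close> \<ge> 1 these intervals tile the numbers from 2 on, so every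
  \<open>m\<close> \<ge> 2 is the upper end of exactly one pair.\<close>

definition star_pairs :: "(nat \<times> nat) set" where
  "star_pairs = {(k, m). 1 \<le> k \<and> fact (k + 1) \<le> m \<and> m < fact (k + 2)}"

lemma star_pairs_subset: "star_pairs \<subseteq> shift_verts"
proof -
  have "k < m" if "fact (k + 1) \<le> m" for k m :: nat
    using that fact_ge_self[of "k + 1"] by linarith
  then show ?thesis
    by (auto simp: star_pairs_def shift_verts_def)
qed

lemma star_pairs_le:
  assumes "(j, m) \<in> star_pairs" "m < fact (k + 2)"
  shows "j \<le> k"
proof -
  have "(fact (j + 1) :: nat) < fact (k + 2)"
    using assms by (auto simp: star_pairs_def)
  then have "j + 1 < k + 2"
    using fact_mono_nat[of "k + 2" "j + 1"] by (meson leD leI)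
  then show ?thesis by simp
qed

text \<open>The intervals of different \<open>k\<close> are disjoint. Pairs can therefore be counted
  by their upper ends.\<close>

lemma inj_on_snd_star_pairs: "inj_on snd star_pairs"
proof -
  have "j \<le> k" if "(j, m) \<in> star_pairs" "(k, m) \<in> star_pairs" for j k m
    using star_pairs_le[OF that(1), of k] that(2) by (auto simp: star_pairs_def)
  then show ?thesis
    by (intro inj_onI) (metis order_antisym prod.collapse)
qed

lemma finite_pairs_upto: "finite (pairs_upto n)"
  by (rule finite_subset[of _ "{..n} \<times> {..n}"]) (auto simp: pairs_upto_def)

text \<open>The star at \<open>k\<close> alone supplies (k+2)! - (k+1)! = (k+1)(k+1)! pairs.\<close>

lemma card_star_pairs_upto_ge:
  assumes "1 \<le> k"
  shows "(k + 1) * fact (k + 1) \<le> card (star_pairs \<inter> pairs_upto (fact (k + 2) - 1))"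
proof -
  let ?J = "{fact (k + 1)..<fact (k + 2)} :: nat set"
  have sub: "{k} \<times> ?J \<subseteq> star_pairs"
    using assms by (auto simp: star_pairs_def)
  then have "{k} \<times> ?J \<subseteq> shift_verts"
    using star_pairs_subset by blast
  then have "{k} \<times> ?J \<subseteq> pairs_upto (fact (k + 2) - 1)"
    by (auto simp: shift_verts_def pairs_upto_def)
  with sub have "card ({k} \<times> ?J) \<le> card (star_pairs \<inter> pairs_upto (fact (k + 2) - 1))"
    by (intro card_mono) (auto simp: finite_pairs_upto)
  moreover have "card ({k} \<times> ?J) = (k + 1) * fact (k + 1)"
    by (simp add: card_cartesian_product algebra_simps)
  ultimately show ?thesis by simp
qed

text \<open>Later stars start beyond the cutoff and the star at \<open>k\<close> is missing, so all
  upper ends that remain lie below (k+1)!.\<close>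

lemma card_upto_le_if_not_lower_end:
  assumes "I \<subseteq> star_pairs" "k \<notin> fst ` I"
  shows "card (I \<inter> pairs_upto (fact (k + 2) - 1)) \<le> fact (k + 1)"
proof -
  let ?P = "I \<inter> pairs_upto (fact (k + 2) - 1)"
  have "snd ` ?P \<subseteq> {..<fact (k + 1)}"
  proof
    fix m assume "m \<in> snd ` ?P"
    then obtain j where "(j, m) \<in> I" and up: "(j, m) \<in> pairs_upto (fact (k + 2) - 1)"
      by (auto simp del: fact_Suc)
    then have star: "(j, m) \<in> star_pairs" and "j \<noteq> k"
      using assms by force+
    have "m \<le> fact (k + 2) - 1"
      using up by (simp add: pairs_upto_def)
    then have "m < fact (k + 2)"
      using fact_gt_zero[of "k + 2", where 'a=nat] by linarith
    then have "j < k"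
      using star_pairs_le[OF star] \<open>j \<noteq> k\<close> by fastforce
    then have "(fact (j + 2) :: nat) \<le> fact (k + 1)"
      by (intro fact_mono) simp
    then have "m < fact (k + 1)"
      using star by (auto simp: star_pairs_def)
    then show "m \<in> {..<fact (k + 1)}" by (rule lessThan_iff[THEN iffD2])
  qed
  then have "card (snd ` ?P) \<le> card {..<fact (k + 1) :: nat}"
    by (intro card_mono) auto
  moreover have "inj_on snd ?P"
    using inj_on_snd_star_pairs by (rule inj_on_subset) (use assms(1) in blast)
  ultimately show ?thesis
    by (simp add: card_image)
qed

lemma independent_ends_disjoint:
  assumes "G \<subseteq> shift_verts" "independent_set_in G (induced_edges shift_edges G) I"
  shows "fst ` I \<inter> snd ` I = {}"
proof -
  have False if "x \<in> I" "y \<in> I" "fst x = snd y" for x y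
  proof -
    have xy: "x \<in> G" "y \<in> G"
      using assms(2) that by (auto simp: independent_set_in_def)
    then have "fst x < snd x"
      using assms(1) by (auto simp: shift_verts_def)
    have "{x, y} \<in> induced_edges shift_edges G"
      using xy assms(1) that(3) unfolding induced_edges_def shift_edges_def by blast
    \<comment> \<open>\<open>indep\<close> only forbids edges between distinct members.\<close>
    moreover have "x \<noteq> y"
      using \<open>fst x < snd x\<close> that(3) by auto
    ultimately show False
      using assms(2) that(1,2) by (auto simp: independent_set_in_def indep_def)
  qed
  then show ?thesis by fastforce
qed

text \<open>The upper ends avoid a cofinite set, so they are bounded, and each bounds its lower
  end.\<close>

lemma finite_if_cofinite_lower_ends:
  assumes "I \<subseteq> shift_verts" "fst ` I \<inter> snd ` I = {}" "finite (- fst ` I)"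
  shows "finite I"
proof -
  have "finite (snd ` I)"
    by (rule finite_subset[OF _ assms(3)]) (use assms(2) in blast)
  then obtain b where "\<And>p. p \<in> I \<Longrightarrow> snd p \<le> b"
    by (meson finite_nat_set_iff_bounded_le imageI)
  then have "I \<subseteq> {..b} \<times> {..b}"
    using assms(1) by (fastforce simp: shift_verts_def)
  then show ?thesis
    by (rule finite_subset) simp
qed

text \<open>The constant \<open>C\<close> gives both cases of the dichotomy one form: it is
  \<open>card I\<close> if \<open>I\<close> is finite, and 1 if infinitely many \<open>k\<close> are
  not lower ends.\<close>

lemma frequently_sparse:
  assumes "I \<subseteq> star_pairs" "fst ` I \<inter> snd ` I = {}"
  obtains C :: nat where
    "\<exists>\<^sub>\<infinity>k. card (I \<inter> pairs_upto (fact (k + 2) - 1)) \<le> C * fact (k + 1)"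
proof (cases "finite (- fst ` I)")
  case True
  have "finite I"
    using subset_trans[OF assms(1) star_pairs_subset] assms(2) True
    by (rule finite_if_cofinite_lower_ends)
  have "card (I \<inter> pairs_upto (fact (k + 2) - 1)) \<le> card I * fact (k + 1)" for k
  proof -
    have "card (I \<inter> pairs_upto (fact (k + 2) - 1)) \<le> card I * 1"
      unfolding mult_1_right using \<open>finite I\<close> Int_lower1 by (rule card_mono)
    also have "\<dots> \<le> card I * fact (k + 1)"
      by (rule mult_le_mono2) (rule fact_ge_1)
    finally show ?thesis .
  qed
  then show ?thesis
    by (intro that[of "card I"]) (auto simp: INFM_nat simp del: fact_Suc)
next
  case False
  then have "\<exists>\<^sub>\<infinity>k. k \<notin> fst ` I"
    by (simp add: frequently_cofinite Compl_eq)
  then have "\<exists>\<^sub>\<infinity>k. card (I \<inter> pairs_upto (fact (k + 2) - 1)) \<le> 1 * fact (k + 1)"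
    unfolding mult_1 by (rule frequently_elim1) (rule card_upto_le_if_not_lower_end[OF assms(1)])
  then show ?thesis by (rule that)
qed

lemma density_arbitrarily_small:
  assumes "I \<subseteq> star_pairs" "fst ` I \<inter> snd ` I = {}" "e > 0"
  shows "\<exists>n\<ge>N. real (card (I \<inter> pairs_upto n)) / real (card (star_pairs \<inter> pairs_upto n)) \<le> e"
proof -
  obtain C where C: "\<exists>\<^sub>\<infinity>k. card (I \<inter> pairs_upto (fact (k + 2) - 1)) \<le> C * fact (k + 1)"
    using frequently_sparse[OF assms(1,2)] by blast
  obtain M where M: "real C / e < real M"
    using reals_Archimedean2 by blast
  \<comment> \<open>\<open>M\<close> makes C/(k+1) smaller than \<open>e\<close>, \<open>N\<close>
    makes the cutoff (k+2)! - 1 at least \<open>N\<close>, and the 1 ensures that \<open>k\<close>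
    is positive, so that there is a star at \<open>k\<close>.\<close>
  obtain k where k: "k \<ge> M + N + 1"
    and small: "card (I \<inter> pairs_upto (fact (k + 2) - 1)) \<le> C * fact (k + 1)"
    using C unfolding INFM_nat_le by blast
  define n where "n = (fact (k + 2) - 1 :: nat)"
  have "n \<ge> N"
    using fact_ge_self[of "k + 2"] k by (simp add: n_def)
  have big: "(k + 1) * fact (k + 1) \<le> card (star_pairs \<inter> pairs_upto n)"
    unfolding n_def by (rule card_star_pairs_upto_ge) (use k in simp)
  have "real (card (I \<inter> pairs_upto n)) \<le> real (C * fact (k + 1))"
    using small unfolding n_def of_nat_le_iff .
  moreover have "real ((k + 1) * fact (k + 1)) \<le> real (card (star_pairs \<inter> pairs_upto n))"
    using big unfolding of_nat_le_iff .
  ultimately have "real (card (I \<inter> pairs_upto n)) / real (card (star_pairs \<inter> pairs_upto n))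
      \<le> real (C * fact (k + 1)) / real ((k + 1) * fact (k + 1))"
    by (intro frac_le) (simp_all add: add_pos_nonneg del: fact_Suc)
  also have "\<dots> = real C / real (k + 1)"
    unfolding of_nat_mult by (rule mult_divide_mult_cancel_right) (simp del: fact_Suc)
  also have "\<dots> \<le> e"
  proof -
    have "real C / e < real (k + 1)"
      using M k by simp
    then show ?thesis
      using assms(3) by (simp add: field_simps)
  qed
  finally show ?thesis
    using \<open>n \<ge> N\<close> by blast
qed

lemma liminf_eq_0_if_arbitrarily_small:
  fixes f :: "nat \<Rightarrow> real"
  assumes "\<And>n. 0 \<le> f n" and "\<And>e N. e > 0 \<Longrightarrow> \<exists>n\<ge>N. f n \<le> e"
  shows "liminf (\<lambda>n. ereal (f n)) = 0"
proof (rule antisym)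
  show "0 \<le> liminf (\<lambda>n. ereal (f n))"
    by (rule Liminf_bounded) (simp add: assms(1))
  show "liminf (\<lambda>n. ereal (f n)) \<le> 0"
  proof (rule ccontr)
    assume "\<not> ?thesis"
    \<comment> \<open>A positive liminf leaves room for a real \<open>e\<close> strictly below it,
      which \<open>f\<close> would eventually exceed.\<close>
    then obtain e where e: "0 < ereal e" "ereal e < liminf (\<lambda>n. ereal (f n))"
      using ereal_dense2[of 0] by (auto simp: not_le)
    from less_LiminfD[OF e(2)] obtain N where "\<And>n. n \<ge> N \<Longrightarrow> e < f n"
      by (auto simp: eventually_sequentially)
    moreover obtain n where "n \<ge> N" "f n \<le> e"
      using assms(2)[of e N] e(1) by auto
    ultimately show False by fastforce
  qed
qed

theorem theorem3p1:
  "\<exists>G. G \<noteq> {} \<and> G \<subseteq> shift_verts \<and>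
     (\<forall>I. independent_set_in G (induced_edges shift_edges G) I \<longrightarrow>
        liminf (\<lambda>n. ereal (real (card (I \<inter> pairs_upto n)) / real (card (G \<inter> pairs_upto n)))) = 0)"
proof (intro exI[of _ star_pairs] conjI allI impI)
  have "(1, 2) \<in> star_pairs"
    by (simp add: star_pairs_def numeral_eq_Suc)
  then show "star_pairs \<noteq> {}" by blast
  show "star_pairs \<subseteq> shift_verts" by (rule star_pairs_subset)
next
  fix I
  assume indep: "independent_set_in star_pairs (induced_edges shift_edges star_pairs) I"
  then have "I \<subseteq> star_pairs"
    by (simp add: independent_set_in_def)
  moreover have "fst ` I \<inter> snd ` I = {}"
    using star_pairs_subset indep by (rule independent_ends_disjoint)
  ultimately show "liminf (\<lambda>n. ereal (real (card (I \<inter> pairs_upto n))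
      / real (card (star_pairs \<inter> pairs_upto n)))) = 0"
    \<comment> \<open>For \<open>n\<close> \<le> 1 the quotient is 0/0, which is 0 by convention;
      these two indices do not affect the liminf.\<close>
    by (intro liminf_eq_0_if_arbitrarily_small density_arbitrarily_small) auto
qed

end
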